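(* Assume that $$f_u(1,0)\int_0^{a_c}\beta(a,1)e^{-\int_0^a\mu(s,1)ds}\,da>1.$$ Then for any $a\in[0,a_m)$ the following assertions hold. (i) For fixed $d>0$, $\int_0^1u^*_{\Lambda,d}(a,x)\,dx\to0$ as $\Lambda\to\infty$. (ii) For fixed $\Lambda>0$, $\int_0^1u^*_{\Lambda,d}(a,x)\,dx\to0$ as $d\to0$.
   Context: Setting. Let $a_m\in(0,\infty]$ (maximum age). The functions $\beta,\mu$ of $(a,x)$, $a\in(0,a_m)$, $x\in[0,1]$, are nonnegative and satisfy: (i) $x\mapsto\beta(\cdot,x)$ is of class $C^2$ from $[0,1]$ to $L^\infty(0,a_m)$, with values in nonnegative functions; (ii) there is $a_c\in(0,a_m)$ such that $\beta\equiv0$ on $[a_c,a_m)\times[0,1]$ and $\int_a^{a_c}\underline\beta(l)\,dl>0$ for every $a\in[0,a_c)$, where $\underline\beta(a)=\min_{x\in[0,1]}\beta(a,x)$; (iii) $x\mapsto\mu(\cdot,x)$ is continuous from $[0,1]$ to $L^\infty_{\rm loc}(0,a_m)$ with values in nonnegative functions, i.e. $\mu(\cdot,x)\in L^\infty(0,a_+)$ for every $a_+<a_m$, continuously in $x$. The function $f=f(x,u)$ satisfies: (i) $f\in C^{2,1}([0,1]\times[0,\infty))$; (ii) $f_u(x,u)>0$ for all $u\in[0,\infty)$, $x\in[0,1]$; (iii) $f(x,0)\equiv0$ and $f(x,u)/u$ is strictly decreasing with respect to $u$ for all $x\in[0,1]$; (iv) there is a constant $L>0$ with $f(x,u)\le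 L$ for all $u\in[0,\infty)$, $x\in[0,1]$. For $d>0$ and $\Lambda\in\mathbb{R}$, $u^*_{\Lambda,d}$ denotes the unique positive solution (positive equilibrium), whenever it exists, of $$\begin{cases}u_a=du_{xx}-\Lambda u_x-\mu(a,x)u,&(a,x)\in(0,a_m)\times(0,1),\\ u(0,x)=f\left(x,\int_0^{a_m}\beta(a,x)u(a,x)\,da\right),&x\in(0,1),\\ du_x(a,x)-\Lambda u(a,x)=0,&(a,x)\in(0,a_m)\times\{0,1\}.\end{cases}$$ Under the hypothesis of the theorem it exists and is unique for fixed $d>0$ and all sufficiently large $\Lambda$, and for fixed $\Lambda>0$ and all sufficiently small $d>0$. *)

theory Defs
  imports "HOL-Analysis.Analysis" "HOL-Probability.Essential_Supremum"
begin

section \<open>Maps from an interval into \<open>L\<^sup>\<infinity>\<close>\<close>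

text \<open>
  A map from \<open>I\<close> to \<open>L\<^sup>\<infinity>(S)\<close> is represented by a function \<open>F a x\<close> with age \<open>a \<in> S\<close> as first
  and position \<open>x \<in> I\<close> as second argument; the value at \<open>x\<close> is the class of \<open>\<lambda>a. F a x\<close>.
\<close>

definition Linf_norm :: "real set \<Rightarrow> (real \<Rightarrow> real) \<Rightarrow> ereal" where
  "Linf_norm S g = esssup (restrict_space lebesgue S) (\<lambda>a. ereal \<bar>g a\<bar>)"

definition in_Linf :: "real set \<Rightarrow> (real \<Rightarrow> real) \<Rightarrow> bool" where
  "in_Linf S g \<longleftrightarrow> g \<in> borel_measurable (restrict_space lebesgue S) \<and> Linf_norm S g < \<infinity>"

definition Linf_continuous_on ::
    "real set \<Rightarrow> real set \<Rightarrow> (real \<Rightarrow> real \<Rightarrow> real) \<Rightarrow> bool" where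
  "Linf_continuous_on I S F \<longleftrightarrow>
     (\<forall>x\<in>I. in_Linf S (\<lambda>a. F a x) \<and>
        ((\<lambda>y. Linf_norm S (\<lambda>a. F a y - F a x)) \<longlongrightarrow> 0) (at x within I))"

definition Linf_has_derivative_on ::
    "real set \<Rightarrow> real set \<Rightarrow> (real \<Rightarrow> real \<Rightarrow> real) \<Rightarrow> (real \<Rightarrow> real \<Rightarrow> real) \<Rightarrow> bool" where
  "Linf_has_derivative_on I S F F' \<longleftrightarrow>
     (\<forall>x\<in>I. ((\<lambda>y. Linf_norm S (\<lambda>a. (F a y - F a x) / (y - x) - F' a x)) \<longlongrightarrow> 0)
        (at x within I))"

definition Linf_C2_on ::
    "real set \<Rightarrow> real set \<Rightarrow> (real \<Rightarrow> real \<Rightarrow> real) \<Rightarrow> bool" where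
  "Linf_C2_on I S F \<longleftrightarrow>
     (\<exists>F1 F2. Linf_continuous_on I S F \<and> Linf_continuous_on I S F1 \<and> Linf_continuous_on I S F2 \<and>
        Linf_has_derivative_on I S F F1 \<and> Linf_has_derivative_on I S F1 F2)"


section \<open>The data of the model\<close>

definition age_range :: "ereal \<Rightarrow> real set" where
  "age_range am = {a. 0 < a \<and> ereal a < am}"

text \<open>
  A continuous map from \<open>[0,1]\<close> to \<open>L\<^sup>\<infinity>\<close> has a representative that is continuous in \<open>x\<close> for
  almost every age. The functions \<open>\<beta>\<close> and \<open>\<mu>\<close> below stand for such representatives. This makes
  the pointwise minimum over \<open>x\<close> in the condition on \<open>\<beta>\<close> meaningful (it is the \<open>INF\<close>, attained
  for almost every \<open>a\<close>), and makes \<open>\<mu>\<close> jointly measurable up to null sets, as needed for an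
  equation that holds for almost every \<open>(a,x)\<close>.
\<close>

definition x_continuous_representative :: "ereal \<Rightarrow> (real \<Rightarrow> real \<Rightarrow> real) \<Rightarrow> bool" where
  "x_continuous_representative am F \<longleftrightarrow>
     (AE a in lebesgue. a \<in> age_range am \<longrightarrow> continuous_on {0..1} (F a))"

definition birth_rate :: "ereal \<Rightarrow> real \<Rightarrow> (real \<Rightarrow> real \<Rightarrow> real) \<Rightarrow> bool" where
  "birth_rate am ac \<beta> \<longleftrightarrow>
     x_continuous_representative am \<beta> \<and>
     (\<forall>a\<in>age_range am. \<forall>x\<in>{0..1}. 0 \<le> \<beta> a x) \<and>
     Linf_C2_on {0..1} (age_range am) \<beta> \<and>
     ac \<in> age_range am \<and>
     (\<forall>a\<in>age_range am. ac \<le> a \<longrightarrow> (\<forall>x\<in>{0..1}. \<beta> a x = 0)) \<and>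
     (\<forall>a\<in>{0..<ac}. 0 < (LINT l:{a..ac}|lebesgue. (INF x\<in>{0..1}. \<beta> l x)))"

definition death_rate :: "ereal \<Rightarrow> (real \<Rightarrow> real \<Rightarrow> real) \<Rightarrow> bool" where
  "death_rate am \<mu> \<longleftrightarrow>
     x_continuous_representative am \<mu> \<and>
     (\<forall>a\<in>age_range am. \<forall>x\<in>{0..1}. 0 \<le> \<mu> a x) \<and>
     (\<forall>b\<in>age_range am. Linf_continuous_on {0..1} {0<..<b} \<mu>)"

text \<open>The partial derivative in \<open>u \<ge> 0\<close>; it is one-sided at \<open>u = 0\<close>.\<close>

definition partial_u :: "(real \<Rightarrow> real \<Rightarrow> real) \<Rightarrow> real \<Rightarrow> real \<Rightarrow> real" where
  "partial_u f x u = vector_derivative (f x) (at u within {0..})"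

text \<open>
  \<open>C\<^sup>2\<^sup>,\<^sup>1([0,1] \<times> [0,\<infinity>))\<close>: twice continuously differentiable in \<open>x\<close>, once in \<open>u\<close>, that is,
  \<open>f\<close>, \<open>f\<^sub>x\<close>, \<open>f\<^sub>x\<^sub>x\<close> and \<open>f\<^sub>u\<close> exist and are jointly continuous.
\<close>

definition C21 :: "(real \<Rightarrow> real \<Rightarrow> real) \<Rightarrow> bool" where
  "C21 f \<longleftrightarrow>
     (\<exists>fx fxx.
        (\<forall>x\<in>{0..1}. \<forall>u\<in>{0..}.
           ((\<lambda>y. f y u) has_real_derivative fx x u) (at x within {0..1}) \<and>
           ((\<lambda>y. fx y u) has_real_derivative fxx x u) (at x within {0..1}) \<and>
           f x differentiable (at u within {0..})) \<and>
        continuous_on ({0..1} \<times> {0..}) (\<lambda>(x, u). f x u) \<and>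
        continuous_on ({0..1} \<times> {0..}) (\<lambda>(x, u). fx x u) \<and>
        continuous_on ({0..1} \<times> {0..}) (\<lambda>(x, u). fxx x u) \<and>
        continuous_on ({0..1} \<times> {0..}) (\<lambda>(x, u). partial_u f x u))"

definition birth_function :: "(real \<Rightarrow> real \<Rightarrow> real) \<Rightarrow> bool" where
  "birth_function f \<longleftrightarrow>
     C21 f \<and>
     (\<forall>x\<in>{0..1}. \<forall>u\<in>{0..}. 0 < partial_u f x u) \<and>
     (\<forall>x\<in>{0..1}. f x 0 = 0) \<and>
     (\<forall>x\<in>{0..1}. strict_antimono_on {0<..} (\<lambda>u. f x u / u)) \<and>
     (\<exists>L>0. \<forall>x\<in>{0..1}. \<forall>u\<in>{0..}. f x u \<le> L)"


section \<open>Positive equilibria\<close>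

text \<open>
  Since \<open>\<mu>\<close> is merely locally bounded and measurable in \<open>a\<close>, the derivatives \<open>u\<^sub>a\<close> and \<open>u\<^sub>x\<^sub>x\<close> of a
  solution need not exist pointwise, and the problem is understood in the sense of strong
  (Sobolev) solutions: \<open>u\<close> is continuous up to age \<open>0\<close>, \<open>u\<^sub>x\<close> exists classically and is continuous
  up to the boundary for positive ages (so that the boundary conditions are meaningful pointwise),
  \<open>u\<^sub>a\<close> and \<open>u\<^sub>x\<^sub>x\<close> are locally integrable, \<open>u\<close> is locally absolutely continuous in \<open>a\<close> on almost
  every line with derivative \<open>u\<^sub>a\<close>, \<open>u\<^sub>x\<close> is absolutely continuous in \<open>x\<close> on almost every line
  with derivative \<open>u\<^sub>x\<^sub>x\<close>, and the differential equation holds almost everywhere.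
\<close>

definition equilibrium ::
    "ereal \<Rightarrow> (real \<Rightarrow> real \<Rightarrow> real) \<Rightarrow> (real \<Rightarrow> real \<Rightarrow> real) \<Rightarrow> (real \<Rightarrow> real \<Rightarrow> real) \<Rightarrow>
     real \<Rightarrow> real \<Rightarrow> (real \<Rightarrow> real \<Rightarrow> real) \<Rightarrow> bool" where
  "equilibrium am \<beta> \<mu> f d \<Lambda> u \<longleftrightarrow>
     (\<exists>ua ux uxx.
        continuous_on (insert 0 (age_range am) \<times> {0..1}) (\<lambda>(a, x). u a x) \<and>
        continuous_on (age_range am \<times> {0..1}) (\<lambda>(a, x). ux a x) \<and>
        (\<forall>a\<in>age_range am. \<forall>x\<in>{0..1}.
           (u a has_real_derivative ux a x) (at x within {0..1})) \<and>
        (\<forall>a1\<in>age_range am. \<forall>a2\<in>age_range am.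
           set_integrable lborel ({a1..a2} \<times> {0..1}) (\<lambda>(a, x). ua a x) \<and>
           set_integrable lborel ({a1..a2} \<times> {0..1}) (\<lambda>(a, x). uxx a x)) \<and>
        (AE x in lborel. x \<in> {0..1} \<longrightarrow>
           (\<forall>a1\<in>age_range am. \<forall>a2\<in>age_range am. a1 \<le> a2 \<longrightarrow>
              set_integrable lborel {a1..a2} (\<lambda>a. ua a x) \<and>
              u a2 x - u a1 x = (LINT a:{a1..a2}|lborel. ua a x))) \<and>
        (AE a in lborel. a \<in> age_range am \<longrightarrow>
           (\<forall>x1\<in>{0..1}. \<forall>x2\<in>{0..1}. x1 \<le> x2 \<longrightarrow>
              set_integrable lborel {x1..x2} (uxx a) \<and>
              ux a x2 - ux a x1 = (LINT x:{x1..x2}|lborel. uxx a x))) \<and>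
        (AE (a, x) in lborel. a \<in> age_range am \<and> x \<in> {0<..<1} \<longrightarrow>
           ua a x = d * uxx a x - \<Lambda> * ux a x - \<mu> a x * u a x) \<and>
        (\<forall>x\<in>{0<..<1}. u 0 x = f x (LINT a:age_range am|lebesgue. \<beta> a x * u a x)) \<and>
        (\<forall>a\<in>age_range am. \<forall>x\<in>{0, 1}. d * ux a x - \<Lambda> * u a x = 0))"

definition positive_equilibrium ::
    "ereal \<Rightarrow> (real \<Rightarrow> real \<Rightarrow> real) \<Rightarrow> (real \<Rightarrow> real \<Rightarrow> real) \<Rightarrow> (real \<Rightarrow> real \<Rightarrow> real) \<Rightarrow>
     real \<Rightarrow> real \<Rightarrow> (real \<Rightarrow> real \<Rightarrow> real) \<Rightarrow> bool" where
  "positive_equilibrium am \<beta> \<mu> f d \<Lambda> u \<longleftrightarrow>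
     equilibrium am \<beta> \<mu> f d \<Lambda> u \<and> (\<forall>a\<in>age_range am. \<forall>x\<in>{0<..<1}. 0 < u a x)"

end

theory Submission
  imports Defs "HOL-Real_Asymp.Real_Asymp"
begin

text \<open>
  Let \<open>U x\<close> be the integral of \<open>u(a, x)\<close> over \<open>a \<in> [0, a\<^sub>c]\<close>. Since \<open>f(x, v)\<close> is at most \<open>C v\<close>
  and \<open>\<beta>\<close> is at most some \<open>B\<close>, the births satisfy \<open>u(0, x) \<le> K U(x)\<close> with \<open>K = C B\<close>. Integrating
  the equation over \<open>[0, a\<^sub>c] \<times> [0, x]\<close> with the no-flux condition at \<open>0\<close>, and once more in \<open>x\<close>,
  shows that the second primitive \<open>V\<close> of \<open>U\<close> vanishing to first order at \<open>0\<close> satisfies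
  \<open>d V'' \<ge> \<Lambda> V' - K V\<close>. If \<open>4 d K \<le> \<Lambda>\<^sup>2\<close> and \<open>r = \<Lambda> / (2 d)\<close>, then \<open>P = V' - r V\<close> satisfies
  \<open>P' \<ge> r P\<close> and \<open>P(0) = 0\<close>, so \<open>P \<ge> 0\<close> and \<open>V(x) \<le> V(1) exp (- r (1 - x))\<close>. The mass is
  nonincreasing in age and \<open>f\<close> is at most \<open>L\<close>, so \<open>V(1) \<le> a\<^sub>c L\<close>. Hence the newborns left of
  \<open>1 - 2 \<delta>\<close> have mass at most \<open>const / \<delta> exp (- r \<delta>)\<close>, those right of it at most \<open>2 \<delta> L\<close>, and
  \<open>r\<close> tends to infinity in both limits.
\<close>

section \<open>Convection-dominated differential inequality\<close>

text \<open>With \<open>r = \<Lambda> / (2 * d)\<close>, the hypotheses give \<open>V'' - 2 r V' +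
  r\<^sup>2 V \<ge> (r\<^sup>2 - K / d) V \<ge> 0\<close>. The left side is the operator
  \<open>D - r\<close> applied twice to \<open>V\<close>, so two first-order comparisons suffice.
  Here \<open>r\<close> is the midpoint of the roots of
  \<open>d s\<^sup>2 - \<Lambda> s + K\<close>, which are real when
  \<open>4 d K \<le> \<Lambda>\<^sup>2\<close>.\<close>

lemma convection_dominated_decay:
  fixes U V W :: "real \<Rightarrow> real"
  assumes V: "\<And>x. x \<in> {0..1} \<Longrightarrow> (V has_real_derivative W x) (at x within {0..1})"
    and W: "\<And>x. x \<in> {0..1} \<Longrightarrow> (W has_real_derivative U x) (at x within {0..1})"
    and "V 0 = 0" "W 0 = 0"
    and V_nonneg: "\<And>x. x \<in> {0..1} \<Longrightarrow> 0 \<le> V x"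
    and ineq: "\<And>x. x \<in> {0..1} \<Longrightarrow> \<Lambda> * W x - K * V x \<le> d * U x"
    and "0 < d" and dK: "4 * d * K \<le> \<Lambda>\<^sup>2"
    and x: "x \<in> {0..1}"
  shows "V x \<le> V 1 * exp (- (\<Lambda> / (2 * d)) * (1 - x))"
proof -
  define r where "r = \<Lambda> / (2 * d)"
  define P where "P x = W x - r * V x" for x
  have at: "(F has_real_derivative D) (at t)"
    if "(F has_real_derivative D) (at t within {0..1})" "0 < t" "t < 1" for F D and t :: real
    using that by (simp add: at_within_Icc_at)
  have cont: "continuous_on {0..1} V" "continuous_on {0..1} W"
    by (rule DERIV_continuous_on[OF V], simp) (rule DERIV_continuous_on[OF W], simp)
  \<comment> \<open>Integrating factor: \<open>F' \<ge> r F\<close> makes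
    \<open>exp (- r y) F(y)\<close> nondecreasing. This serves first for \<open>P\<close> and then
    for \<open>V\<close>.\<close>
  have mono: "exp (- r * s) * F s \<le> exp (- r * t) * F t"
    if F: "\<And>y. 0 < y \<Longrightarrow> y < 1 \<Longrightarrow> \<exists>D. (F has_real_derivative D) (at y) \<and> r * F y \<le> D"
      and "continuous_on {0..1} F" and st: "0 \<le> s" "s \<le> t" "t \<le> 1" for F and s t :: real
  proof (rule DERIV_nonneg_imp_increasing_open[OF st(2)])
    show "continuous_on {s..t} (\<lambda>y. exp (- r * y) * F y)"
      by (intro continuous_intros continuous_on_subset[OF \<open>continuous_on {0..1} F\<close>]) (use st in auto)
    fix y assume y: "s < y" "y < t"
    then obtain D where D: "(F has_real_derivative D) (at y)" "r * F y \<le> D"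
      using F[of y] st by auto
    have "((\<lambda>y. exp (- r * y) * F y) has_real_derivative exp (- r * y) * (D - r * F y)) (at y)"
      using D(1) by (auto intro!: derivative_eq_intros simp: algebra_simps)
    then show "\<exists>D'. ((\<lambda>y. exp (- r * y) * F y) has_real_derivative D') (at y) \<and> 0 \<le> D'"
      using D(2) by (intro exI conjI) auto
  qed
  have P_nonneg: "0 \<le> P y" if "y \<in> {0..1}" for y
  proof -
    have "exp (- r * 0) * P 0 \<le> exp (- r * y) * P y"
    proof (rule mono)
      show "continuous_on {0..1} P"
        unfolding P_def by (intro continuous_intros cont)
      fix t :: real assume t: "0 < t" "t < 1"
      \<comment> \<open>This is the discriminant condition divided by \<open>4 d\<^sup>2\<close>; it
        lets \<open>r\<^sup>2 V\<close> absorb the reaction term because \<open>V\<close> is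
        nonnegative.\<close>
      have "K / d \<le> r\<^sup>2"
        using dK \<open>0 < d\<close> by (simp add: r_def field_simps power2_eq_square)
      then have "K / d * V t \<le> r\<^sup>2 * V t"
        using V_nonneg[of t] t by (intro mult_right_mono) auto
      moreover have "2 * r * W t - K / d * V t \<le> U t"
        using ineq[of t] t \<open>0 < d\<close> by (simp add: r_def field_simps)
      ultimately have "r * P t \<le> U t - r * W t"
        by (simp add: P_def algebra_simps power2_eq_square)
      moreover have "(P has_real_derivative U t - r * W t) (at t)"
        unfolding P_def using at[OF V] at[OF W] t by (auto intro!: derivative_eq_intros)
      ultimately show "\<exists>D. (P has_real_derivative D) (at t) \<and> r * P t \<le> D"
        by blast
    qed (use that in auto)
    then show ?thesis
      using \<open>V 0 = 0\<close> \<open>W 0 = 0\<close> by (simp add: P_def zero_le_mult_iff)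
  qed
  \<comment> \<open>Now \<open>V' = P + r V \<ge> r V\<close>, and the monotone quantity is compared
    between \<open>x\<close> and the right end.\<close>
  have "exp (- r * x) * V x \<le> exp (- r * 1) * V 1"
  proof (rule mono)
    fix t :: real assume t: "0 < t" "t < 1"
    show "\<exists>D. (V has_real_derivative D) (at t) \<and> r * V t \<le> D"
      using at[OF V, of t] P_nonneg[of t] t by (auto simp: P_def)
  qed (use x cont in auto)
  then have "V x \<le> exp (r * x) * (exp (- r) * V 1)"
    by (simp add: exp_minus field_simps)
  also have "\<dots> = V 1 * exp (- r * (1 - x))"
    by (simp add: mult_exp_exp[symmetric] algebra_simps exp_diff exp_minus divide_inverse)
  finally show ?thesis
    by (simp add: r_def)
qed

section \<open>Integrals and slices of functions on a box\<close>

lemma continuous_on_slices: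
  assumes "continuous_on S (\<lambda>(s, y). F s y)"
  shows continuous_on_slice_fst: "A \<times> {y} \<subseteq> S \<Longrightarrow> continuous_on A (\<lambda>s. F s y)"
    and continuous_on_slice_snd: "{s} \<times> B \<subseteq> S \<Longrightarrow> continuous_on B (F s)"
proof -
  show "continuous_on A (\<lambda>s. F s y)" if "A \<times> {y} \<subseteq> S"
  proof -
    have "continuous_on A (\<lambda>s. (\<lambda>(s, y). F s y) (s, y))"
      by (rule continuous_on_compose2[OF assms]) (use that in \<open>auto intro!: continuous_intros\<close>)
    then show ?thesis by simp
  qed
  show "continuous_on B (F s)" if "{s} \<times> B \<subseteq> S"
  proof -
    have "continuous_on B (\<lambda>y. (\<lambda>(s, y). F s y) (s, y))"
      by (rule continuous_on_compose2[OF assms]) (use that in \<open>auto intro!: continuous_intros\<close>)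
    then show ?thesis by simp
  qed
qed

text \<open>Fubini for the line identities of strong solutions, where the inner integral is known
  only on almost every line. Integrability of \<open>G\<close> and \<open>H\<close> supplies the
  measurability that replacing the inner integral almost everywhere requires.\<close>

lemma set_integral_lborel_box:
  fixes g :: "real \<Rightarrow> real \<Rightarrow> real"
  assumes g: "set_integrable lborel (A \<times> B) (\<lambda>(s, y). g s y)"
  shows set_integral_lborel_box_fst:
      "set_integrable lborel A G \<Longrightarrow> (AE s\<in>A in lborel. (LINT y:B|lborel. g s y) = G s) \<Longrightarrow>
       (LINT p:A \<times> B|lborel. (case p of (s, y) \<Rightarrow> g s y)) = (LINT s:A|lborel. G s)" (is "_ \<Longrightarrow> _ \<Longrightarrow> ?fst")
    and set_integral_lborel_box_snd:
      "set_integrable lborel B H \<Longrightarrow> (AE y\<in>B in lborel. (LINT s:A|lborel. g s y) = H y) \<Longrightarrow>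
       (LINT p:A \<times> B|lborel. (case p of (s, y) \<Rightarrow> g s y)) = (LINT y:B|lborel. H y)" (is "_ \<Longrightarrow> _ \<Longrightarrow> ?snd")
proof -
  let ?h = "\<lambda>s y. indicator A s * (indicator B y * g s y)"
  have int: "integrable (lborel \<Otimes>\<^sub>M lborel) (\<lambda>(s, y). ?h s y)"
    using g unfolding set_integrable_def
    by (simp add: lborel_prod indicator_times case_prod_unfold mult.assoc)
  have eq: "(LINT p:A \<times> B|lborel. (case p of (s, y) \<Rightarrow> g s y)) =
      integral\<^sup>L (lborel \<Otimes>\<^sub>M lborel) (\<lambda>(s, y). ?h s y)"
    unfolding set_lebesgue_integral_def lborel_prod
    by (simp add: indicator_times case_prod_unfold mult.assoc)
  show ?fst if G: "set_integrable lborel A G" "AE s\<in>A in lborel. (LINT y:B|lborel. g s y) = G s"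
  proof -
    have "(LINT s|lborel. LINT y|lborel. ?h s y) = (LINT s|lborel. indicator A s *\<^sub>R G s)"
    proof (rule integral_cong_AE)
      show "AE s in lborel. (LINT y|lborel. ?h s y) = indicator A s *\<^sub>R G s"
        using G(2) by eventually_elim (auto simp: set_lebesgue_integral_def indicator_def)
    qed (use lborel_pair.integrable_fst[OF int] G(1) in
         \<open>auto simp: set_integrable_def intro: borel_measurable_integrable\<close>)
    then show ?thesis
      using lborel_pair.integral_fst[OF int] unfolding eq by (simp add: set_lebesgue_integral_def)
  qed
  show ?snd if H: "set_integrable lborel B H" "AE y\<in>B in lborel. (LINT s:A|lborel. g s y) = H y"
  proof -
    have "(LINT y|lborel. LINT s|lborel. ?h s y) = (LINT y|lborel. indicator B y *\<^sub>R H y)"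
    proof (rule integral_cong_AE)
      show "AE y in lborel. (LINT s|lborel. ?h s y) = indicator B y *\<^sub>R H y"
        using H(2) by eventually_elim (auto simp: set_lebesgue_integral_def indicator_def)
    qed (use lborel_pair.integrable_snd[OF int] H(1) in
         \<open>auto simp: set_integrable_def intro: borel_measurable_integrable\<close>)
    then show ?thesis
      using lborel_pair.integral_snd[OF int] unfolding eq by (simp add: set_lebesgue_integral_def)
  qed
qed

text \<open>The differential equation is assumed only for \<open>x\<close> in the open interval;
  this removes the boundary lines \<open>x = 0\<close> and \<open>x = 1\<close> from boxes over a
  closed one.\<close>

lemma AE_lborel_snd_neq: "AE p in (lborel :: (real \<times> real) measure). snd p \<noteq> c"
proof (rule AE_I')
  have "emeasure (lborel \<Otimes>\<^sub>M lborel) (UNIV \<times> {c}) = emeasure lborel (UNIV::real set) * emeasure lborel {c}"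
    by (simp add: lborel.emeasure_pair_measure_Times)
  then show "UNIV \<times> {c} \<in> null_sets (lborel :: (real \<times> real) measure)"
    by (auto simp: null_sets_def lborel_prod closed_Times intro!: borel_closed)
qed auto

section \<open>Integration of continuous functions over intervals\<close>

lemma has_integral_derivative_Icc:
  fixes g g' :: "real \<Rightarrow> real"
  assumes g: "\<And>y. y \<in> {0..1} \<Longrightarrow> (g has_real_derivative g' y) (at y within {0..1})" and x: "x \<in> {0..1}"
  shows "(g' has_integral (g x - g 0)) {0..x}"
proof (rule fundamental_theorem_of_calculus)
  fix y assume "y \<in> {0..x}"
  then have "(g has_real_derivative g' y) (at y within {0..x})"
    using x by (intro DERIV_subset[OF g]) auto
  then show "(g has_vector_derivative g' y) (at y within {0..x})"
    by (simp add: has_real_derivative_iff_has_vector_derivative)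
qed (use x in auto)

lemma integral_mult_diff:
  fixes F G :: "real \<Rightarrow> real"
  assumes "F integrable_on S" "G integrable_on S"
  shows "integral S (\<lambda>x. k * F x - l * G x) = k * integral S F - l * integral S G"
  by (intro integral_unique has_integral_diff has_integral_mult_right integrable_integral assms)

lemma integral_swap_real:
  fixes F :: "real \<Rightarrow> real \<Rightarrow> real"
  assumes "continuous_on ({a..b} \<times> {c..d}) (\<lambda>(s, y). F s y)"
  shows "integral {a..b} (\<lambda>s. integral {c..d} (F s)) = integral {c..d} (\<lambda>y. integral {a..b} (\<lambda>s. F s y))"
  using integral_swap_continuous[of a c b d F] assms by (simp add: cbox_Pair_eq)

lemma continuous_on_integral_fst:
  fixes F :: "real \<Rightarrow> real \<Rightarrow> real"
  assumes "continuous_on ({a..b} \<times> {c..d}) (\<lambda>(s, y). F s y)"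
  shows "continuous_on {a..b} (\<lambda>s. integral {c..d} (F s))"
  using integral_continuous_on_param[of "{a..b}" c d F] assms by simp

lemma continuous_on_integral_snd:
  fixes F :: "real \<Rightarrow> real \<Rightarrow> real"
  assumes "continuous_on ({a..b} \<times> {c..d}) (\<lambda>(s, y). F s y)"
  shows "continuous_on {c..d} (\<lambda>y. integral {a..b} (\<lambda>s. F s y))"
proof -
  have "continuous_on ({c..d} \<times> {a..b}) (\<lambda>p. (\<lambda>(s, y). F s y) (snd p, fst p))"
    by (rule continuous_on_compose2[OF assms]) (auto intro!: continuous_intros)
  then have "continuous_on ({c..d} \<times> {a..b}) (\<lambda>(y, s). F s y)"
    by (simp add: case_prod_unfold)
  then show ?thesis by (rule continuous_on_integral_fst)
qed

text \<open>The birth law is imposed only at interior points; by density and continuity the bounds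
  derived from it persist at both ends.\<close>

lemma closure_extend_le:
  fixes g h :: "real \<Rightarrow> real"
  assumes "continuous_on {0..1} g" "continuous_on {0..1} h"
    and le: "\<And>x. x \<in> {0<..<1} \<Longrightarrow> g x \<le> h x" and x: "x \<in> {0..1}"
  shows "g x \<le> h x"
proof -
  have cl: "closure {0<..<1::real} = {0..1}"
    by (rule closure_greaterThanLessThan) simp
  have "g x - h x \<le> 0"
  proof (rule continuous_le_on_closure[where S = "{0<..<1}" and f = "\<lambda>x. g x - h x"], unfold cl)
    show "continuous_on {0..1} (\<lambda>x. g x - h x)"
      by (intro continuous_intros assms)
  qed (use x le in auto)
  then show ?thesis by simp
qed

section \<open>Bounds on the coefficients\<close>

lemma AE_le_of_Linf_norm_less:
  assumes "S \<in> sets lebesgue" "Linf_norm S g < ereal B"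
  shows "AE a in lebesgue. a \<in> S \<longrightarrow> \<bar>g a\<bar> \<le> B"
proof -
  have "AE a in restrict_space lebesgue S. ereal \<bar>g a\<bar> \<le> Linf_norm S g"
    unfolding Linf_norm_def by (rule esssup_AE)
  then have "AE a in restrict_space lebesgue S. \<bar>g a\<bar> \<le> B"
  proof eventually_elim
    case (elim a)
    then have "ereal \<bar>g a\<bar> \<le> ereal B"
      using assms(2) by order
    then show ?case by simp
  qed
  then show ?thesis
    using assms(1) by (simp add: AE_restrict_space_iff)
qed

text \<open>A bound \<open>b\<close> at \<open>x\<close> becomes \<open>b + 1\<close> wherever the
  norm distance to the value at \<open>x\<close> is below 1, and finitely many such neighbourhoods
  cover \<open>I\<close>. The exceptional null set may vary with \<open>x\<close>, which is enough
  for birth integrals estimated one \<open>x\<close> at a time.\<close>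

lemma Linf_continuous_on_compact_bound:
  assumes F: "Linf_continuous_on I S F" and "compact I" and S: "S \<in> sets lebesgue"
  shows "\<exists>B>0. \<forall>x\<in>I. AE a in lebesgue. a \<in> S \<longrightarrow> \<bar>F a x\<bar> \<le> B"
proof -
  have "\<exists>T B. open T \<and> x \<in> T \<and> (\<forall>y\<in>T \<inter> I. AE a in lebesgue. a \<in> S \<longrightarrow> \<bar>F a y\<bar> \<le> B)"
    if "x \<in> I" for x
  proof -
    have "Linf_norm S (\<lambda>a. F a x) < \<infinity>"
      using F \<open>x \<in> I\<close> by (auto simp: Linf_continuous_on_def in_Linf_def)
    then obtain b where b: "Linf_norm S (\<lambda>a. F a x) < ereal b"
      using ereal_dense2 by blast
    have Fx: "AE a in lebesgue. a \<in> S \<longrightarrow> \<bar>F a x\<bar> \<le> b"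
      by (rule AE_le_of_Linf_norm_less[OF S b])
    have "((\<lambda>y. Linf_norm S (\<lambda>a. F a y - F a x)) \<longlongrightarrow> 0) (at x within I)"
      using F \<open>x \<in> I\<close> by (auto simp: Linf_continuous_on_def)
    then have "\<forall>\<^sub>F y in at x within I. Linf_norm S (\<lambda>a. F a y - F a x) < ereal 1"
      by (rule order_tendstoD) simp
    then obtain T where T: "open T" "x \<in> T"
      "\<And>y. y \<in> T \<Longrightarrow> y \<noteq> x \<Longrightarrow> y \<in> I \<Longrightarrow> Linf_norm S (\<lambda>a. F a y - F a x) < ereal 1"
      unfolding eventually_at_topological by blast
    have "AE a in lebesgue. a \<in> S \<longrightarrow> \<bar>F a y\<bar> \<le> b + 1" if "y \<in> T \<inter> I" for y
    proof (cases "y = x")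
      case False
      then have "AE a in lebesgue. a \<in> S \<longrightarrow> \<bar>F a y - F a x\<bar> \<le> 1"
        using AE_le_of_Linf_norm_less[OF S T(3)[of y]] that by auto
      with Fx show ?thesis
        by eventually_elim auto
    qed (use Fx in \<open>auto elim: eventually_mono\<close>)
    with T(1,2) show ?thesis by blast
  qed
  then obtain T B where TB: "\<And>x. x \<in> I \<Longrightarrow> open (T x)" "\<And>x. x \<in> I \<Longrightarrow> x \<in> T x"
    "\<And>x y. x \<in> I \<Longrightarrow> y \<in> T x \<inter> I \<Longrightarrow> AE a in lebesgue. a \<in> S \<longrightarrow> \<bar>F a y\<bar> \<le> B x"
    by metis
  obtain X where X: "X \<subseteq> I" "finite X" "I \<subseteq> (\<Union>x\<in>X. T x)"
    using compactE_image[OF \<open>compact I\<close>, of I T] TB(1,2) by blast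
  \<comment> \<open>The sum dominates each of the finitely many local bounds, and the summand 1
    makes it positive even for empty \<open>X\<close>.\<close>
  define M where "M = 1 + (\<Sum>x\<in>X. \<bar>B x\<bar>)"
  have "AE a in lebesgue. a \<in> S \<longrightarrow> \<bar>F a y\<bar> \<le> M" if "y \<in> I" for y
  proof -
    obtain x where x: "x \<in> X" "y \<in> T x"
      using X(3) \<open>y \<in> I\<close> by blast
    have "B x \<le> M"
      using member_le_sum[of x X "\<lambda>x. \<bar>B x\<bar>"] x(1) X(2) by (auto simp: M_def)
    moreover have "AE a in lebesgue. a \<in> S \<longrightarrow> \<bar>F a y\<bar> \<le> B x"
      using TB(3)[of x y] x X(1) that by auto
    ultimately show ?thesis
      by (auto elim: eventually_mono)
  qed
  moreover have "M > 0"
    unfolding M_def by (simp add: add_pos_nonneg sum_nonneg)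
  ultimately show ?thesis by blast
qed

lemma age_range_measurable: "age_range am \<in> sets lebesgue"
proof -
  have "age_range am = {0<..} \<inter> ereal -` {..<am}"
    by (auto simp: age_range_def)
  also have "\<dots> \<in> sets lebesgue"
    by (auto intro!: open_Int open_vimage continuous_intros continuous_on_ereal simp: borel_open)
  finally show ?thesis .
qed

lemma atLeastAtMost_subset_age_range:
  assumes "a2 \<in> age_range am" "0 < a1" shows "{a1..a2} \<subseteq> age_range am"
proof -
  have "ereal t < am" if "t \<le> a2" for t
    using assms(1) that le_less_trans[of "ereal t" "ereal a2"] by (auto simp: age_range_def)
  then show ?thesis using assms(2) by (auto simp: age_range_def)
qed

section \<open>Growth of the birth function and size of the birth integral\<close>

text \<open>The decreasing quotient \<open>f x v / v\<close> lies below its limit as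
  \<open>v\<close> tends to 0 from the right, which is the one-sided derivative at 0.\<close>

lemma birth_function_le_tangent:
  assumes f: "birth_function f" and x: "x \<in> {0..1}" and "0 \<le> v"
  shows "f x v \<le> partial_u f x 0 * v"
proof (cases "v = 0")
  case True
  then show ?thesis using f x by (simp add: birth_function_def)
next
  case False
  then have "0 < v" using \<open>0 \<le> v\<close> by simp
  have f0: "f x 0 = 0" and anti: "strict_antimono_on {0<..} (\<lambda>u. f x u / u)"
    and diff: "f x differentiable (at 0 within {0..})"
    using f x by (auto simp: birth_function_def C21_def)
  have "(f x has_vector_derivative partial_u f x 0) (at 0 within {0..})"
    unfolding partial_u_def using diff by (rule vector_derivative_works[THEN iffD1])
  then have "(f x has_real_derivative partial_u f x 0) (at 0 within {0..})"
    by (simp add: has_real_derivative_iff_has_vector_derivative)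
  \<comment> \<open>Since \<open>f x 0 = 0\<close>, the difference quotient at 0 is exactly
    \<open>f x w / w\<close>.\<close>
  then have lim: "((\<lambda>w. f x w / w) \<longlongrightarrow> partial_u f x 0) (at_right 0)"
    by (auto simp: has_field_derivative_iff f0 at_within_Ici_at_right)
  have "\<forall>\<^sub>F w in at_right 0. f x v / v \<le> f x w / w"
    using eventually_at_right_real[OF \<open>0 < v\<close>]
  proof eventually_elim
    case (elim w)
    then show ?case
      using monotone_onD[OF anti, of w v] by (auto simp: less_imp_le)
  qed
  then have "f x v / v \<le> partial_u f x 0"
    by (rule tendsto_lowerbound[OF lim]) simp
  then show ?thesis using \<open>0 < v\<close> by (simp add: field_simps)
qed

text \<open>The slope at \<open>u = 0\<close> depends continuously on \<open>x\<close> in a compact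
  interval, so one constant bounds all tangents.\<close>

lemma birth_function_linear_bound:
  assumes f: "birth_function f"
  shows "\<exists>C>0. \<forall>x\<in>{0..1}. \<forall>v\<ge>0. f x v \<le> C * v"
proof -
  have "continuous_on ({0..1} \<times> {0..}) (\<lambda>(x, u). partial_u f x u)"
    using f by (auto simp: birth_function_def C21_def)
  then have "continuous_on {0..1} (\<lambda>x. (\<lambda>(x, u). partial_u f x u) (x, 0))"
    by (rule continuous_on_compose2) (auto intro!: continuous_intros)
  then have "bounded ((\<lambda>x. partial_u f x 0) ` {0..1})"
    by (intro compact_imp_bounded compact_continuous_image) auto
  then obtain C where C: "0 < C" "\<And>x. x \<in> {0..1} \<Longrightarrow> \<bar>partial_u f x 0\<bar> \<le> C"
    by (auto simp: bounded_pos)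
  show ?thesis
  proof (intro exI[of _ C] conjI ballI allI impI)
    fix x v :: real assume x: "x \<in> {0..1}" and "0 \<le> v"
    have "f x v \<le> partial_u f x 0 * v"
      by (rule birth_function_le_tangent[OF f x \<open>0 \<le> v\<close>])
    also have "\<dots> \<le> C * v"
      using C(2)[OF x] \<open>0 \<le> v\<close> by (intro mult_right_mono) auto
    finally show "f x v \<le> C * v" .
  qed fact
qed

text \<open>Beyond \<open>ac\<close> the birth rate vanishes, so only ages up to \<open>ac\<close>
  contribute, and there it is at most \<open>B\<close> almost everywhere.\<close>

lemma birth_rate_integral_le:
  assumes \<beta>: "birth_rate am ac \<beta>" and x: "x \<in> {0..1}"
    and B: "0 \<le> B" "AE s in lebesgue. s \<in> age_range am \<longrightarrow> \<bar>\<beta> s x\<bar> \<le> B"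
    and g: "continuous_on {0..ac} g" "\<And>s. s \<in> {0..ac} \<Longrightarrow> 0 \<le> g s"
  shows "(LINT s:age_range am|lebesgue. \<beta> s x * g s) \<le> B * integral {0..ac} g"
proof (cases "set_integrable lebesgue (age_range am) (\<lambda>s. \<beta> s x * g s)")
  case True
  have ac: "ac \<in> age_range am" and zero: "\<And>s. s \<in> age_range am \<Longrightarrow> ac \<le> s \<Longrightarrow> \<beta> s x = 0"
    using \<beta> x by (auto simp: birth_rate_def)
  have int: "set_integrable lebesgue {0..ac} g"
    using absolutely_integrable_continuous_real[OF g(1)] .
  have "(LINT s:age_range am|lebesgue. \<beta> s x * g s) \<le> (LINT s:{0..ac}|lebesgue. B * g s)"
    unfolding set_lebesgue_integral_def
  proof (rule integral_mono_AE)
    show "AE s in lebesgue. indicator (age_range am) s *\<^sub>R (\<beta> s x * g s) \<le> indicator {0..ac} s *\<^sub>R (B * g s)"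
      using B(2)
    proof eventually_elim
      case (elim s)
      show ?case
      proof (cases "s \<in> age_range am \<and> s < ac")
        case True
        then have "s \<in> {0..ac}" by (auto simp: age_range_def)
        with True elim g(2)[of s] show ?thesis
          by (auto intro!: mult_right_mono)
      next
        case False
        then have "indicator (age_range am) s *\<^sub>R (\<beta> s x * g s) = 0"
          using zero[of s] by (auto simp: indicator_def)
        then show ?thesis using B(1) g(2)[of s] by (auto simp: indicator_def)
      qed
    qed
  qed (use True set_integrable_mult_right[OF int, of B] in \<open>auto simp: set_integrable_def\<close>)
  also have "\<dots> = B * integral {0..ac} g"
    using set_lebesgue_integral_eq_integral(2)[OF int] by simp
  finally show ?thesis .
next
  \<comment> \<open>A product that is not integrable has integral 0 by convention, and the
    right-hand side is nonnegative; no separate integrability proof is required.\<close>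
  case False
  then have "(LINT s:age_range am|lebesgue. \<beta> s x * g s) = 0"
    by (simp add: set_integrable_def set_lebesgue_integral_def not_integrable_integral_eq)
  then show ?thesis
    using B(1) integral_nonneg[OF integrable_continuous_real[OF g(1)] g(2)] by simp
qed

section \<open>Mass and flux of an equilibrium\<close>

text \<open>The equation is integrated over \<open>{a1..a2} \<times> {0..x}\<close>. Mortality has a
  sign and is discarded, which turns the balance into an inequality; the no-flux condition at 0
  leaves only the flux through \<open>x\<close>. The derivative \<open>ux\<close> is returned
  together with its properties, so that the weak data \<open>ua\<close> and \<open>uxx\<close> do
  not appear again.\<close>

lemma equilibrium_flux:
  assumes eq: "positive_equilibrium am \<beta> \<mu> f d \<Lambda> u"
    and \<mu>: "death_rate am \<mu>"
  obtains ux where "continuous_on (age_range am \<times> {0..1}) (\<lambda>(a, x). ux a x)"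
    and "\<forall>a\<in>age_range am. \<forall>x\<in>{0..1}. (u a has_real_derivative ux a x) (at x within {0..1})"
    and "\<forall>a\<in>age_range am. d * ux a 1 = \<Lambda> * u a 1"
    and "\<forall>a1\<in>age_range am. \<forall>a2\<in>age_range am. \<forall>x\<in>{0..1}. a1 \<le> a2 \<longrightarrow>
      integral {0..x} (u a2) - integral {0..x} (u a1) \<le> integral {a1..a2} (\<lambda>a. d * ux a x - \<Lambda> * u a x)"
proof -
  from eq obtain ua ux uxx where
    u_cont: "continuous_on (insert 0 (age_range am) \<times> {0..1}) (\<lambda>(a, x). u a x)" and
    ux_cont: "continuous_on (age_range am \<times> {0..1}) (\<lambda>(a, x). ux a x)" and
    ux': "\<forall>a\<in>age_range am. \<forall>x\<in>{0..1}. (u a has_real_derivative ux a x) (at x within {0..1})" and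
    int: "\<forall>a1\<in>age_range am. \<forall>a2\<in>age_range am.
       set_integrable lborel ({a1..a2} \<times> {0..1}) (\<lambda>(a, x). ua a x) \<and>
       set_integrable lborel ({a1..a2} \<times> {0..1}) (\<lambda>(a, x). uxx a x)" and
    ua: "AE x in lborel. x \<in> {0..1} \<longrightarrow>
           (\<forall>a1\<in>age_range am. \<forall>a2\<in>age_range am. a1 \<le> a2 \<longrightarrow>
              set_integrable lborel {a1..a2} (\<lambda>a. ua a x) \<and>
              u a2 x - u a1 x = (LINT a:{a1..a2}|lborel. ua a x))" and
    uxx: "AE a in lborel. a \<in> age_range am \<longrightarrow>
           (\<forall>x1\<in>{0..1}. \<forall>x2\<in>{0..1}. x1 \<le> x2 \<longrightarrow>
              set_integrable lborel {x1..x2} (uxx a) \<and>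
              ux a x2 - ux a x1 = (LINT x:{x1..x2}|lborel. uxx a x))" and
    pde: "AE (a, x) in lborel. a \<in> age_range am \<and> x \<in> {0<..<1} \<longrightarrow>
           ua a x = d * uxx a x - \<Lambda> * ux a x - \<mu> a x * u a x" and
    bdry': "\<forall>a\<in>age_range am. \<forall>x\<in>{0, 1}. d * ux a x - \<Lambda> * u a x = 0"
    unfolding positive_equilibrium_def equilibrium_def by (elim conjE exE)
  have ux: "(u a has_real_derivative ux a x) (at x within {0..1})"
    if "a \<in> age_range am" "x \<in> {0..1}" for a x
    using ux' that by blast
  have bdry: "d * ux a 0 = \<Lambda> * u a 0" "d * ux a 1 = \<Lambda> * u a 1" if "a \<in> age_range am" for a
    using bdry' that by simp_all
  have pos: "\<And>a x. a \<in> age_range am \<Longrightarrow> x \<in> {0<..<1} \<Longrightarrow> 0 < u a x"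
    using eq by (auto simp: positive_equilibrium_def)
  show thesis
  proof (rule that[OF ux_cont ux'], use bdry(2) in blast, intro ballI impI)
    fix a1 a2 x :: real
    assume a: "a1 \<in> age_range am" "a2 \<in> age_range am" and x: "x \<in> {0..1}" and "a1 \<le> a2"
    let ?S = "{a1..a2} \<times> {0..x}"
    \<comment> \<open>Starting at a positive age keeps the box inside the region where
      \<open>ux\<close> is continuous.\<close>
    have "0 < a1" using a(1) by (simp add: age_range_def)
    have sub: "{a1..a2} \<subseteq> age_range am"
      by (rule atLeastAtMost_subset_age_range[OF a(2) \<open>0 < a1\<close>])
    have S: "?S \<in> sets lborel" "?S \<subseteq> {a1..a2} \<times> {0..1}"
      using x by (auto intro!: borel_closed closed_Times)
    have ua_int: "set_integrable lborel ?S (\<lambda>(a, x). ua a x)"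
      and uxx_int: "set_integrable lborel ?S (\<lambda>(a, x). uxx a x)"
      using int a(1,2) S by (blast intro: set_integrable_subset)+
    have ux_int: "set_integrable lborel ?S (\<lambda>(a, x). ux a x)"
      unfolding set_integrable_def
      by (intro borel_integrable_compact compact_Times compact_Icc continuous_on_subset[OF ux_cont])
        (use sub x in auto)
    have line: "continuous_on {a1..a2} (\<lambda>a. ux a y)" "continuous_on {a1..a2} (\<lambda>a. u a y)" if "y \<in> {0..1}" for y
      using that sub by (auto intro!: continuous_on_slice_fst[OF ux_cont] continuous_on_slice_fst[OF u_cont])
    have u_line: "continuous_on {0..1} (u s)" if "s \<in> age_range am" for s
      using that by (intro continuous_on_slice_snd[OF u_cont]) auto
    have u_int: "u s integrable_on {0..x}" if "s \<in> age_range am" for s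
      using x by (intro integrable_continuous_real continuous_on_subset[OF u_line[OF that]]) auto
    have diff_cont: "continuous_on {0..x} (\<lambda>y. u a2 y - u a1 y)"
      using x by (intro continuous_intros continuous_on_subset[OF u_line] a) auto
    \<comment> \<open>The age derivative is integrated first in age, along almost every line of
      constant place; the two space derivatives below are integrated first in
      \<open>x\<close>.\<close>
    have "(LINT p:?S|lborel. (case p of (a, x) \<Rightarrow> ua a x)) = (LINT y:{0..x}|lborel. u a2 y - u a1 y)"
      using ua a x \<open>a1 \<le> a2\<close>
      by (intro set_integral_lborel_box_snd[OF ua_int] borel_integrable_atLeastAtMost'[OF diff_cont])
        (auto elim!: eventually_mono)
    also have "\<dots> = integral {0..x} (\<lambda>y. u a2 y - u a1 y)"
      by (rule set_borel_integral_eq_integral(2)[OF borel_integrable_atLeastAtMost'[OF diff_cont]])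
    also have "\<dots> = integral {0..x} (u a2) - integral {0..x} (u a1)"
      using a u_int by (intro integral_diff) auto
    finally have ua_eq: "(LINT p:?S|lborel. (case p of (a, x) \<Rightarrow> ua a x)) = integral {0..x} (u a2) - integral {0..x} (u a1)" .
    have c1: "continuous_on {a1..a2} (\<lambda>a. ux a x - ux a 0)"
      and c2: "continuous_on {a1..a2} (\<lambda>a. u a x - u a 0)"
      using x by (auto intro!: continuous_intros line)
    have "(LINT p:?S|lborel. (case p of (a, x) \<Rightarrow> uxx a x)) = (LINT a:{a1..a2}|lborel. ux a x - ux a 0)"
      using uxx sub x
      by (intro set_integral_lborel_box_fst[OF uxx_int] borel_integrable_atLeastAtMost'[OF c1])
        (auto elim!: eventually_mono)
    also have "\<dots> = integral {a1..a2} (\<lambda>a. ux a x - ux a 0)"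
      by (rule set_borel_integral_eq_integral(2)[OF borel_integrable_atLeastAtMost'[OF c1]])
    finally have uxx_eq: "(LINT p:?S|lborel. (case p of (a, x) \<Rightarrow> uxx a x)) = integral {a1..a2} (\<lambda>a. ux a x - ux a 0)" .
    have ftc: "(LINT y:{0..x}|lborel. ux s y) = u s x - u s 0" if s: "s \<in> age_range am" for s
    proof -
      have "continuous_on {0..x} (ux s)"
        using s x by (intro continuous_on_slice_snd[OF ux_cont]) auto
      then have "(LINT y:{0..x}|lborel. ux s y) = integral {0..x} (ux s)"
        by (intro set_borel_integral_eq_integral(2) borel_integrable_atLeastAtMost')
      also have "\<dots> = u s x - u s 0"
        by (rule integral_unique[OF has_integral_derivative_Icc[OF ux[OF s] x]])
      finally show ?thesis .
    qed
    have "(LINT p:?S|lborel. (case p of (a, x) \<Rightarrow> ux a x)) = (LINT a:{a1..a2}|lborel. u a x - u a 0)"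
      using sub
      by (intro set_integral_lborel_box_fst[OF ux_int] borel_integrable_atLeastAtMost'[OF c2] AE_I2 impI ftc) auto
    also have "\<dots> = integral {a1..a2} (\<lambda>a. u a x - u a 0)"
      by (rule set_borel_integral_eq_integral(2)[OF borel_integrable_atLeastAtMost'[OF c2]])
    finally have ux_eq: "(LINT p:?S|lborel. (case p of (a, x) \<Rightarrow> ux a x)) = integral {a1..a2} (\<lambda>a. u a x - u a 0)" .
    have rhs_int: "set_integrable lborel ?S (\<lambda>p. d * (case p of (a, x) \<Rightarrow> uxx a x))"
      "set_integrable lborel ?S (\<lambda>p. \<Lambda> * (case p of (a, x) \<Rightarrow> ux a x))"
      using uxx_int ux_int by auto
    have "(LINT p:?S|lborel. (case p of (a, x) \<Rightarrow> ua a x)) \<le>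
        (LINT p:?S|lborel. d * (case p of (a, x) \<Rightarrow> uxx a x) - \<Lambda> * (case p of (a, x) \<Rightarrow> ux a x))"
    proof (rule set_integral_mono_AE[OF ua_int set_integral_diff(1)[OF rhs_int]])
      show "AE p\<in>?S in lborel. (case p of (a, x) \<Rightarrow> ua a x) \<le>
          d * (case p of (a, x) \<Rightarrow> uxx a x) - \<Lambda> * (case p of (a, x) \<Rightarrow> ux a x)"
        using pde AE_lborel_snd_neq[of 0] AE_lborel_snd_neq[of 1]
      proof eventually_elim
        case (elim p)
        obtain s y where p: "p = (s, y)" by (cases p)
        show ?case
        proof
          assume "p \<in> ?S"
          then have s: "s \<in> age_range am" and y: "y \<in> {0<..<1}"
            using elim(2,3) sub x by (auto simp: p)
          \<comment> \<open>This nonnegative mortality term is the only loss in the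
            estimate.\<close>
          have "0 \<le> \<mu> s y * u s y"
            using \<mu> s pos[OF s y] y by (simp add: death_rate_def)
          then show "(case p of (a, x) \<Rightarrow> ua a x) \<le>
              d * (case p of (a, x) \<Rightarrow> uxx a x) - \<Lambda> * (case p of (a, x) \<Rightarrow> ux a x)"
            using elim(1) s y by (simp add: p)
        qed
      qed
    qed
    also have "\<dots> = d * integral {a1..a2} (\<lambda>a. ux a x - ux a 0) - \<Lambda> * integral {a1..a2} (\<lambda>a. u a x - u a 0)"
      by (subst set_integral_diff(2)[OF rhs_int]) (simp only: set_integral_mult_right uxx_eq ux_eq)
    also have "\<dots> = integral {a1..a2} (\<lambda>a. d * (ux a x - ux a 0) - \<Lambda> * (u a x - u a 0))"
      by (rule integral_mult_diff[symmetric]) (intro integrable_continuous_real c1 c2)+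
    also have "\<dots> = integral {a1..a2} (\<lambda>a. d * ux a x - \<Lambda> * u a x)"
    proof (rule integral_cong)
      fix s assume "s \<in> {a1..a2}"
      \<comment> \<open>No flux at the left end: the contributions at 0 cancel.\<close>
      then have "d * ux s 0 = \<Lambda> * u s 0"
        using sub bdry(1) by blast
      then show "d * (ux s x - ux s 0) - \<Lambda> * (u s x - u s 0) = d * ux s x - \<Lambda> * u s x"
        by (simp add: algebra_simps)
    qed
    finally show "integral {0..x} (u a2) - integral {0..x} (u a1) \<le> integral {a1..a2} (\<lambda>a. d * ux a x - \<Lambda> * u a x)"
      unfolding ua_eq .
  qed
qed

section \<open>Continuity, sign and mass balance of one equilibrium up to a fixed age\<close>

context
  fixes am :: ereal and \<beta> \<mu> f u :: "real \<Rightarrow> real \<Rightarrow> real" and d \<Lambda> a2 :: real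
  assumes eq: "positive_equilibrium am \<beta> \<mu> f d \<Lambda> u"
    and \<mu>: "death_rate am \<mu>"
    and a2: "a2 \<in> age_range am"
begin

lemma equilibrium_continuous: "continuous_on ({0..a2} \<times> {0..1}) (\<lambda>(a, x). u a x)"
proof -
  have "{0..a2} \<subseteq> insert 0 (age_range am)"
  proof
    fix s assume "s \<in> {0..a2}"
    then show "s \<in> insert 0 (age_range am)"
      using atLeastAtMost_subset_age_range[OF a2, of s] by (cases "s = 0") auto
  qed
  moreover have "continuous_on (insert 0 (age_range am) \<times> {0..1}) (\<lambda>(a, x). u a x)"
    using eq by (auto simp: positive_equilibrium_def equilibrium_def)
  ultimately show ?thesis
    by (elim continuous_on_subset) auto
qed

lemma equilibrium_continuous_age: "s \<in> {0..a2} \<Longrightarrow> continuous_on {0..1} (u s)"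
  by (intro continuous_on_slice_snd[OF equilibrium_continuous]) auto

lemma equilibrium_continuous_place: "x \<in> {0..1} \<Longrightarrow> continuous_on {0..a2} (\<lambda>a. u a x)"
  by (intro continuous_on_slice_fst[OF equilibrium_continuous]) auto

lemma equilibrium_integrable_age:
  "s \<in> {0..a2} \<Longrightarrow> 0 \<le> y \<Longrightarrow> z \<le> 1 \<Longrightarrow> u s integrable_on {y..z}"
  by (rule integrable_continuous_real, rule continuous_on_subset[OF equilibrium_continuous_age]) auto

text \<open>Positivity in the interior passes to the closed box by continuity, and so reaches age 0
  and both ends.\<close>

lemma equilibrium_nonneg:
  assumes "s \<in> {0..a2}" "x \<in> {0..1}"
  shows "0 \<le> u s x"
proof -
  have "0 < a2" using a2 by (simp add: age_range_def)
  then have cl: "closure ({0<..<a2} \<times> {0<..<1::real}) = {0..a2} \<times> {0..1}"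
    by (simp add: closure_Times)
  have "0 \<le> (\<lambda>(a, x). u a x) (s, x)"
  proof (rule continuous_ge_on_closure[where S = "{0<..<a2} \<times> {0<..<1}"], unfold cl)
    fix p assume "p \<in> {0<..<a2} \<times> {0<..<1::real}"
    then show "0 \<le> (\<lambda>(a, x). u a x) p"
      using eq atLeastAtMost_subset_age_range[OF a2, of "fst p"]
      by (force simp: positive_equilibrium_def less_imp_le)
  qed (use equilibrium_continuous assms in auto)
  then show ?thesis by simp
qed

text \<open>The flux estimate needs positive ages; this links it to age 0. Uniform continuity on the
  compact box brings \<open>u a1\<close> within \<open>\<eta>\<close> of \<open>u 0\<close> at all
  places at once, hence one \<open>a1\<close> works for every \<open>x\<close>.\<close>

lemma eventually_initial_mass_le:
  assumes "0 < \<eta>"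
  shows "\<forall>\<^sub>F a1 in at_right 0. 0 < a1 \<and> a1 < a2 \<and>
    (\<forall>x\<in>{0..1}. integral {0..x} (u a1) \<le> integral {0..x} (u 0) + \<eta>)"
proof -
  have "0 < a2" using a2 by (simp add: age_range_def)
  have "uniformly_continuous_on ({0..a2} \<times> {0..1}) (\<lambda>(a, x). u a x)"
    by (rule compact_uniformly_continuous[OF equilibrium_continuous]) (intro compact_Times compact_Icc)
  then obtain \<delta> where \<delta>: "0 < \<delta>" and close: "\<And>p q. p \<in> {0..a2} \<times> {0..1} \<Longrightarrow> q \<in> {0..a2} \<times> {0..1} \<Longrightarrow>
      dist q p < \<delta> \<Longrightarrow> dist ((\<lambda>(a, x). u a x) q) ((\<lambda>(a, x). u a x) p) < \<eta>"
    using assms by (rule uniformly_continuous_onE) blast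
  have "\<forall>\<^sub>F a1 in at_right 0. a1 \<in> {0<..<min \<delta> a2}"
    using \<delta> \<open>0 < a2\<close> by (intro eventually_at_right_real) simp
  then show ?thesis
  proof eventually_elim
    case (elim a1)
    have "integral {0..x} (u a1) \<le> integral {0..x} (u 0) + \<eta>" if x: "x \<in> {0..1}" for x
    proof -
      have int: "u s integrable_on {0..x}" if "s \<in> {0..a2}" for s
        using equilibrium_integrable_age[OF that, of 0 x] x by simp
      have "integral {0..x} (u a1) \<le> integral {0..x} (\<lambda>y. u 0 y + \<eta>)"
      proof (rule integral_le)
        fix y assume "y \<in> {0..x}"
        then have "dist (u a1 y) (u 0 y) < \<eta>"
          using close[of "(0, y)" "(a1, y)"] elim x by (auto simp: dist_Pair_Pair)
        then show "u a1 y \<le> u 0 y + \<eta>"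
          by (auto simp: dist_real_def)
      qed (use int elim \<open>0 < a2\<close> in \<open>auto intro!: integrable_add\<close>)
      also have "\<dots> = integral {0..x} (u 0) + x * \<eta>"
        using int[of 0] \<open>0 < a2\<close> x by (subst integral_add) auto
      also have "x * \<eta> \<le> \<eta>"
        using x \<open>0 < \<eta>\<close> by (simp add: mult_left_le_one_le)
      finally show ?thesis by simp
    qed
    with elim show ?case by auto
  qed
qed

text \<open>At \<open>x = 1\<close> the flux vanishes, so mass cannot grow between a small positive
  age and \<open>a2\<close>; that age then tends to 0, at the cost of an arbitrary
  \<open>\<eta>\<close>.\<close>

lemma equilibrium_mass_le: "integral {0..1} (u a2) \<le> integral {0..1} (u 0)"
proof (rule field_le_epsilon)
  fix \<eta> :: real assume "0 < \<eta>"
  obtain ux where "continuous_on (age_range am \<times> {0..1}) (\<lambda>(a, x). ux a x)"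
    and "\<forall>a\<in>age_range am. \<forall>x\<in>{0..1}. (u a has_real_derivative ux a x) (at x within {0..1})"
    and bdry: "\<forall>a\<in>age_range am. d * ux a 1 = \<Lambda> * u a 1"
    and flux: "\<forall>a1\<in>age_range am. \<forall>a2\<in>age_range am. \<forall>x\<in>{0..1}. a1 \<le> a2 \<longrightarrow>
      integral {0..x} (u a2) - integral {0..x} (u a1) \<le> integral {a1..a2} (\<lambda>a. d * ux a x - \<Lambda> * u a x)"
    by (rule equilibrium_flux[OF eq \<mu>])
  have "\<exists>a1. 0 < a1 \<and> a1 < a2 \<and>
    (\<forall>x\<in>{0..1}. integral {0..x} (u a1) \<le> integral {0..x} (u 0) + \<eta>)"
    using eventually_happens'[OF _ eventually_initial_mass_le[OF \<open>0 < \<eta>\<close>]] by simp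
  then obtain a1 where a1: "0 < a1" "a1 < a2" "integral {0..1} (u a1) \<le> integral {0..1} (u 0) + \<eta>"
    by auto
  have sub: "{a1..a2} \<subseteq> age_range am"
    by (rule atLeastAtMost_subset_age_range[OF a2 \<open>0 < a1\<close>])
  have "integral {0..1} (u a2) - integral {0..1} (u a1) \<le> integral {a1..a2} (\<lambda>a. d * ux a 1 - \<Lambda> * u a 1)"
    using a1 sub a2 by (intro flux[rule_format]) auto
  also have "\<dots> = integral {a1..a2} (\<lambda>a. 0)"
    using bdry sub by (intro integral_cong) auto
  finally show "integral {0..1} (u a2) \<le> integral {0..1} (u 0) + \<eta>"
    using a1(3) by simp
qed

text \<open>Integrating the flux estimate once more in \<open>x\<close> replaces \<open>ux\<close>
  by differences of \<open>u\<close>. The outcome involves only functions continuous down to age 0,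
  so the lower age limit can be sent to 0.\<close>

lemma equilibrium_integrated_flux:
  assumes z: "z \<in> {0..1}"
  defines "U \<equiv> \<lambda>x. integral {0..a2} (\<lambda>a. u a x)"
  shows "\<Lambda> * integral {0..z} U - d * (U z - U 0) \<le> integral {0..z} (\<lambda>x. integral {0..x} (u 0))"
proof -
  have "0 < a2" using a2 by (simp add: age_range_def)
  obtain ux where ux_cont: "continuous_on (age_range am \<times> {0..1}) (\<lambda>(a, x). ux a x)"
    and ux: "\<forall>a\<in>age_range am. \<forall>x\<in>{0..1}. (u a has_real_derivative ux a x) (at x within {0..1})"
    and "\<forall>a\<in>age_range am. d * ux a 1 = \<Lambda> * u a 1"
    and flux: "\<forall>a1\<in>age_range am. \<forall>a2\<in>age_range am. \<forall>x\<in>{0..1}. a1 \<le> a2 \<longrightarrow>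
      integral {0..x} (u a2) - integral {0..x} (u a1) \<le> integral {a1..a2} (\<lambda>a. d * ux a x - \<Lambda> * u a x)"
    by (rule equilibrium_flux[OF eq \<mu>])
  have box: "continuous_on ({0..a2} \<times> {0..z}) (\<lambda>(a, x). u a x)"
    by (rule continuous_on_subset[OF equilibrium_continuous]) (use z in auto)
  \<comment> \<open>The negative flux integrated over \<open>{0..z}\<close>, written without
    \<open>ux\<close> so that it makes sense and is continuous at age 0.\<close>
  define G where "G a = \<Lambda> * integral {0..z} (u a) - d * (u a z - u a 0)" for a
  have G_cont: "continuous_on {0..a2} G"
    unfolding G_def using z
    by (intro continuous_intros continuous_on_integral_fst[OF box] equilibrium_continuous_place) auto
  have U_int: "(\<lambda>a. u a x) integrable_on {0..a2}" if "x \<in> {0..1}" for x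
    using equilibrium_continuous_place[OF that] by (rule integrable_continuous_real)
  have "integral {0..a2} G = \<Lambda> * integral {0..a2} (\<lambda>a. integral {0..z} (u a)) - d * integral {0..a2} (\<lambda>a. u a z - u a 0)"
    unfolding G_def using z
    by (intro integral_mult_diff integrable_continuous_real continuous_intros continuous_on_integral_fst[OF box]
        equilibrium_continuous_place) auto
  also have "integral {0..a2} (\<lambda>a. u a z - u a 0) = U z - U 0"
    unfolding U_def using z by (intro integral_diff U_int) auto
  also have "integral {0..a2} (\<lambda>a. integral {0..z} (u a)) = integral {0..z} U"
    unfolding U_def by (rule integral_swap_real[OF box])
  finally have G_eq: "integral {0..a2} G = \<Lambda> * integral {0..z} U - d * (U z - U 0)" .
  have prim_int: "(\<lambda>x. integral {0..x} (u 0)) integrable_on {0..z}"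
    using z \<open>0 < a2\<close>
    by (intro integrable_continuous_real indefinite_integral_continuous_1 equilibrium_integrable_age) auto
  have "integral {0..a2} G \<le> integral {0..z} (\<lambda>x. integral {0..x} (u 0)) + \<eta>" if "0 < \<eta>" for \<eta>
  proof -
    have "\<forall>\<^sub>F a1 in at_right 0. integral {a1..a2} G \<le> integral {0..z} (\<lambda>x. integral {0..x} (u 0)) + \<eta>"
      using eventually_initial_mass_le[OF \<open>0 < \<eta>\<close>]
    proof eventually_elim
      case (elim a1)
      then have sub: "{a1..a2} \<subseteq> age_range am" and "a1 < a2" "0 < a1"
        using atLeastAtMost_subset_age_range[OF a2, of a1] by auto
      \<comment> \<open>The negative flux itself, available for positive ages; its space integral is
        \<open>G\<close>.\<close>
      define h where "h a x = \<Lambda> * u a x - d * ux a x" for a x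
      have h_cont: "continuous_on ({a1..a2} \<times> {0..z}) (\<lambda>(a, x). h a x)"
      proof -
        have "continuous_on ({a1..a2} \<times> {0..z}) (\<lambda>p. \<Lambda> * (case p of (a, x) \<Rightarrow> u a x) - d * (case p of (a, x) \<Rightarrow> ux a x))"
          by (intro continuous_intros continuous_on_subset[OF box] continuous_on_subset[OF ux_cont])
            (use sub z \<open>0 < a1\<close> in auto)
        then show ?thesis by (simp add: h_def case_prod_unfold)
      qed
      have hG: "integral {0..z} (h a) = G a" if a: "a \<in> {a1..a2}" for a
      proof -
        have "(ux a has_integral (u a z - u a 0)) {0..z}"
          using a sub by (intro has_integral_derivative_Icc[OF ux[rule_format] z]) auto
        moreover have "(u a has_integral integral {0..z} (u a)) {0..z}"
          using a \<open>0 < a1\<close> z by (intro integrable_integral equilibrium_integrable_age) auto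
        ultimately have "(h a has_integral G a) {0..z}"
          unfolding h_def G_def by (intro has_integral_diff has_integral_mult_right)
        then show ?thesis by (rule integral_unique)
      qed
      have "integral {a1..a2} G = integral {a1..a2} (\<lambda>a. integral {0..z} (h a))"
        by (intro integral_cong) (simp add: hG)
      also have "\<dots> = integral {0..z} (\<lambda>x. integral {a1..a2} (\<lambda>a. h a x))"
        by (rule integral_swap_real[OF h_cont])
      also have "\<dots> \<le> integral {0..z} (\<lambda>x. integral {0..x} (u 0) + \<eta>)"
      proof (rule integral_le)
        show "(\<lambda>x. integral {a1..a2} (\<lambda>a. h a x)) integrable_on {0..z}"
          by (intro integrable_continuous_real continuous_on_integral_snd[OF h_cont])
        show "(\<lambda>x. integral {0..x} (u 0) + \<eta>) integrable_on {0..z}"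
          using prim_int by (intro integrable_add) auto
        fix x assume "x \<in> {0..z}"
        then have x: "x \<in> {0..1}" using z by auto
        have "a1 \<in> age_range am" using sub \<open>a1 < a2\<close> by auto
        then have "integral {0..x} (u a2) - integral {0..x} (u a1) \<le> integral {a1..a2} (\<lambda>a. d * ux a x - \<Lambda> * u a x)"
          using flux a2 x \<open>a1 < a2\<close> by (meson less_imp_le)
        moreover have "integral {a1..a2} (\<lambda>a. h a x) = - integral {a1..a2} (\<lambda>a. d * ux a x - \<Lambda> * u a x)"
          by (subst integral_neg[symmetric]) (simp add: h_def)
        \<comment> \<open>The mass still present at age \<open>a2\<close> is dropped, leaving only
          that of the newborns up to \<open>\<eta>\<close>.\<close>
        moreover have "0 \<le> integral {0..x} (u a2)"
          using x \<open>0 < a2\<close> by (intro integral_nonneg equilibrium_integrable_age equilibrium_nonneg) auto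
        moreover have "integral {0..x} (u a1) \<le> integral {0..x} (u 0) + \<eta>"
          using elim x by blast
        ultimately show "integral {a1..a2} (\<lambda>a. h a x) \<le> integral {0..x} (u 0) + \<eta>"
          by linarith
      qed
      also have "\<dots> = integral {0..z} (\<lambda>x. integral {0..x} (u 0)) + z * \<eta>"
        using z prim_int by (subst integral_add) auto
      also have "z * \<eta> \<le> \<eta>"
        using z \<open>0 < \<eta>\<close> by (simp add: mult_left_le_one_le)
      finally show ?case by simp
    qed
    \<comment> \<open>Continuity of \<open>G\<close> on the closed age interval allows
      \<open>a1\<close> to tend to 0 in the bound just proved.\<close>
    moreover have "((\<lambda>a1. integral {a1..a2} G) \<longlongrightarrow> integral {0..a2} G) (at_right 0)"
      using indefinite_integral_continuous_1'[OF integrable_continuous_real[OF G_cont]] \<open>0 < a2\<close>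
      by (auto simp: continuous_on_def at_within_Icc_at_right dest!: bspec[of _ _ 0])
    ultimately show ?thesis
      by (intro tendsto_upperbound[where F = "at_right (0::real)"]) simp_all
  qed
  then show ?thesis
    unfolding G_eq by (rule field_le_epsilon)
qed

end

section \<open>Concentration at the downstream end\<close>

text \<open>A quantitative form of the concentration: besides the condition
  \<open>4 * d * (C * B) \<le> \<Lambda>\<^sup>2\<close>, the parameters enter only through
  \<open>\<Lambda> / (2 * d)\<close>. The width \<open>\<delta>\<close> of the layer at
  \<open>x = 1\<close> stays free, to be chosen before the limit is taken.\<close>

lemma equilibrium_mass_bound:
  fixes am :: ereal
  assumes \<beta>: "birth_rate am ac \<beta>" and \<mu>: "death_rate am \<mu>"
    and eq: "positive_equilibrium am \<beta> \<mu> f d \<Lambda> u"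
    and B: "0 < B" "\<forall>x\<in>{0..1}. AE s in lebesgue. s \<in> age_range am \<longrightarrow> \<bar>\<beta> s x\<bar> \<le> B"
    and C: "0 < C" "\<forall>x\<in>{0..1}. \<forall>v\<ge>0. f x v \<le> C * v"
    and L: "0 < L" "\<forall>x\<in>{0..1}. \<forall>v\<ge>0. f x v \<le> L"
    and d: "0 < d" and \<Lambda>: "4 * d * (C * B) \<le> \<Lambda>\<^sup>2"
    and \<delta>: "0 < \<delta>" "\<delta> < 1 / 2"
    and a: "0 \<le> a" "ereal a < am"
  shows "0 \<le> (LINT x:{0..1}|lborel. u a x)"
    and "(LINT x:{0..1}|lborel. u a x) \<le> C * B * ac * L / \<delta> * exp (- (\<delta> * \<Lambda> / (2 * d))) + 2 * \<delta> * L"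
proof -
  have ac: "ac \<in> age_range am" using \<beta> by (simp add: birth_rate_def)
  then have "0 < ac" by (simp add: age_range_def)
  define K where "K = C * B"
  have "0 < K" using B C by (simp add: K_def)
  note cont = equilibrium_continuous[OF eq \<mu>]
    and cont_age = equilibrium_continuous_age[OF eq \<mu>]
    and cont_place = equilibrium_continuous_place[OF eq \<mu>]
    and nonneg = equilibrium_nonneg[OF eq \<mu>]
  \<comment> \<open>Reproduction takes place before age \<open>ac\<close>, so \<open>U\<close>
    controls the births; \<open>W\<close> and \<open>V\<close> are its first and second primitives
    vanishing at 0.\<close>
  define U where "U x = integral {0..ac} (\<lambda>s. u s x)" for x
  define W where "W x = integral {0..x} U" for x
  define V where "V x = integral {0..x} W" for x
  have U_cont: "continuous_on {0..1} U"
    unfolding U_def by (rule continuous_on_integral_snd[OF cont[OF ac]])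
  have W_deriv: "(W has_real_derivative U x) (at x within {0..1})" if "x \<in> {0..1}" for x
    unfolding W_def by (rule integral_has_real_derivative[OF U_cont that])
  have W_cont: "continuous_on {0..1} W"
    by (rule DERIV_continuous_on[OF W_deriv])
  have V_deriv: "(V has_real_derivative W x) (at x within {0..1})" if "x \<in> {0..1}" for x
    unfolding V_def by (rule integral_has_real_derivative[OF W_cont that])
  have U_int: "U integrable_on {x..y}" and W_int: "W integrable_on {x..y}" if "0 \<le> x" "y \<le> 1" for x y
    using that by (auto intro!: integrable_continuous_real continuous_on_subset[OF U_cont] continuous_on_subset[OF W_cont])
  have U_nonneg: "0 \<le> U x" if "x \<in> {0..1}" for x
    unfolding U_def using that ac
    by (intro integral_nonneg integrable_continuous_real cont_place[OF ac] nonneg[OF ac]) auto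
  have W_mono: "W x \<le> W y" if "0 \<le> x" "x \<le> y" "y \<le> 1" for x y
    unfolding W_def using that by (intro integral_subset_le ballI U_int U_nonneg) auto
  have W_nonneg: "0 \<le> W x" if "x \<in> {0..1}" for x
    using W_mono[of 0 x] that by (simp add: W_def)
  have V_nonneg: "0 \<le> V x" if "x \<in> {0..1}" for x
    unfolding V_def using that by (intro integral_nonneg W_int W_nonneg) auto

  have zero: "V 0 = 0" "W 0 = 0"
    by (simp_all add: V_def W_def)

  \<comment> \<open>The linear bound closes the inequality for \<open>V\<close>; the saturation
    bound \<open>L\<close> controls \<open>V 1\<close> and the layer near
    \<open>x = 1\<close>.\<close>
  have births: "u 0 x \<le> K * U x" "u 0 x \<le> L" if x: "x \<in> {0<..<1}" for x
  proof -
    let ?v = "LINT s:age_range am|lebesgue. \<beta> s x * u s x"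
    have x': "x \<in> {0..1}" using x by auto
    from eq have "\<forall>x\<in>{0<..<1}. u 0 x = f x (LINT s:age_range am|lebesgue. \<beta> s x * u s x)"
      unfolding positive_equilibrium_def equilibrium_def by (elim conjE exE)
    then have u0: "u 0 x = f x ?v"
      using x by blast
    have "0 \<le> ?v"
      unfolding set_lebesgue_integral_def
    proof (rule integral_nonneg_AE, rule AE_I2)
      fix s
      show "0 \<le> indicator (age_range am) s *\<^sub>R (\<beta> s x * u s x)"
        using \<beta> eq x x' by (auto simp: indicator_def birth_rate_def positive_equilibrium_def less_imp_le)
    qed
    moreover have "?v \<le> B * U x"
      unfolding U_def using B x'
      by (intro birth_rate_integral_le[OF \<beta>] cont_place[OF ac] nonneg[OF ac]) auto
    then have "C * ?v \<le> K * U x"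
      using C(1) by (simp add: K_def mult.assoc)
    ultimately show "u 0 x \<le> K * U x" "u 0 x \<le> L"
      using C(2) L(2) x' unfolding u0 by fastforce+
  qed
  have cont0: "continuous_on {0..1} (u 0)"
    using \<open>0 < ac\<close> by (intro cont_age[OF ac]) auto
  have u0_K: "u 0 x \<le> K * U x" if "x \<in> {0..1}" for x
    using cont0 _ births(1) that by (rule closure_extend_le) (intro continuous_intros U_cont)
  have u0_L: "u 0 x \<le> L" if "x \<in> {0..1}" for x
    using cont0 _ births(2) that by (rule closure_extend_le) (intro continuous_intros)
  have u0_int: "u 0 integrable_on {x..y}" if "0 \<le> x" "y \<le> 1" for x y
    using that by (auto intro!: integrable_continuous_real continuous_on_subset[OF cont0])
  have u0_mass: "integral {x..y} (u 0) \<le> (y - x) * L" if "0 \<le> x" "x \<le> y" "y \<le> 1" for x y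
    using integral_le[of "u 0" "{x..y}" "\<lambda>_. L"] u0_int u0_L that by auto
  have u0_mass_W: "integral {0..x} (u 0) \<le> K * W x" if "x \<in> {0..1}" for x
  proof -
    have "integral {0..x} (u 0) \<le> integral {0..x} (\<lambda>y. K * U y)"
      using that by (intro integral_le u0_int u0_K integrable_on_mult_right U_int) auto
    then show ?thesis by (simp add: W_def)
  qed
  \<comment> \<open>Age 0 is split off because the monotonicity of mass was proved for positive
    ages.\<close>
  have mass_le: "integral {0..1} (u s) \<le> integral {0..1} (u 0)" if "0 \<le> s" "ereal s < am" for s
  proof (cases "s = 0")
    case False
    with that have "s \<in> age_range am" by (simp add: age_range_def)
    then show ?thesis by (rule equilibrium_mass_le[OF eq \<mu>])
  qed simp

  \<comment> \<open>As \<open>W\<close> is nondecreasing, \<open>V 1 \<le> W 1\<close>, the total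
    population up to age \<open>ac\<close>; each age contributes at most the newborn mass, hence at
    most \<open>L\<close>.\<close>
  have V1: "V 1 \<le> ac * L"
  proof -
    have "V 1 \<le> integral {0..1} (\<lambda>_::real. W 1)"
      unfolding V_def by (intro integral_le W_int W_mono) auto
    also have "\<dots> = W 1" by simp
    also have "W 1 = integral {0..ac} (\<lambda>s. integral {0..1} (u s))"
      unfolding W_def U_def by (rule integral_swap_real[OF cont[OF ac], symmetric])
    also have "\<dots> \<le> integral {0..ac} (\<lambda>_. L)"
    proof (rule integral_le)
      show "(\<lambda>s. integral {0..1} (u s)) integrable_on {0..ac}"
        by (intro integrable_continuous_real continuous_on_integral_fst cont[OF ac])
      fix s assume s: "s \<in> {0..ac}"
      then have "ereal s < am"
        using ac by (auto simp: age_range_def intro: le_less_trans[of "ereal s" "ereal ac"])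
      then show "integral {0..1} (u s) \<le> L"
        using mass_le[of s] u0_mass[of 0 1] s by simp
    qed (rule integrable_const_ivl)
    finally show ?thesis using \<open>0 < ac\<close> by simp
  qed

  have "V (1 - \<delta>) \<le> V 1 * exp (- (\<Lambda> / (2 * d)) * (1 - (1 - \<delta>)))"
  proof (rule convection_dominated_decay[where W = W and U = U and K = K])
    fix z :: real assume z: "z \<in> {0..1}"
    have "\<Lambda> * W z - d * (U z - U 0) \<le> integral {0..z} (\<lambda>x. integral {0..x} (u 0))"
      unfolding W_def U_def by (rule equilibrium_integrated_flux[OF eq \<mu> ac z])
    also have "\<dots> \<le> integral {0..z} (\<lambda>x. K * W x)"
      using z by (intro integral_le u0_mass_W integrable_on_mult_right W_int
          integrable_continuous_real indefinite_integral_continuous_1 u0_int) auto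
    also have "\<dots> = K * V z" by (simp add: V_def)
    finally have "\<Lambda> * W z - K * V z \<le> d * U z - d * U 0"
      by (simp add: algebra_simps)
    \<comment> \<open>The boundary value \<open>U 0\<close> enters with a favourable sign.\<close>
    also have "\<dots> \<le> d * U z"
      using d U_nonneg[of 0] by simp
    finally show "\<Lambda> * W z - K * V z \<le> d * U z" .
  qed (use V_deriv W_deriv V_nonneg zero d \<Lambda> \<delta> in \<open>auto simp: K_def\<close>)
  also have "\<dots> \<le> ac * L * exp (- (\<delta> * \<Lambda> / (2 * d)))"
    using V1 by (auto intro!: mult_mono simp: algebra_simps)
  finally have V_le: "V (1 - \<delta>) \<le> ac * L * exp (- (\<delta> * \<Lambda> / (2 * d)))" .
  \<comment> \<open>Monotonicity of \<open>W\<close> on an interval of length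
    \<open>\<delta>\<close> turns the bound on its primitive into one on \<open>W\<close>. One
    \<open>\<delta>\<close> is spent here and one in the exponent, which explains the split at
    \<open>1 - 2 * \<delta>\<close>.\<close>
  have "\<delta> * W (1 - 2 * \<delta>) = integral {1 - 2 * \<delta>..1 - \<delta>} (\<lambda>_. W (1 - 2 * \<delta>))"
    using \<delta> by simp
  also have "\<dots> \<le> integral {1 - 2 * \<delta>..1 - \<delta>} W"
    using \<delta> by (intro integral_le W_int W_mono) auto
  also have "\<dots> \<le> V (1 - \<delta>)"
    unfolding V_def using \<delta> by (intro integral_subset_le ballI W_int W_nonneg) auto
  also note V_le
  finally have W_le: "W (1 - 2 * \<delta>) \<le> ac * L / \<delta> * exp (- (\<delta> * \<Lambda> / (2 * d)))"
    using \<delta> by (simp add: field_simps)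
  have "integral {0..1} (u 0) = integral {0..1 - 2 * \<delta>} (u 0) + integral {1 - 2 * \<delta>..1} (u 0)"
    using \<delta> by (intro Henstock_Kurzweil_Integration.integral_combine[symmetric] u0_int) auto
  also have "\<dots> \<le> K * W (1 - 2 * \<delta>) + 2 * \<delta> * L"
    using u0_mass_W[of "1 - 2 * \<delta>"] u0_mass[of "1 - 2 * \<delta>" 1] \<delta> by simp
  also have "\<dots> \<le> K * (ac * L / \<delta> * exp (- (\<delta> * \<Lambda> / (2 * d)))) + 2 * \<delta> * L"
    using \<open>0 < K\<close> by (intro add_right_mono mult_left_mono W_le) simp
  finally have bound: "integral {0..1} (u a) \<le> C * B * ac * L / \<delta> * exp (- (\<delta> * \<Lambda> / (2 * d))) + 2 * \<delta> * L"
    using mass_le[OF a] by (simp add: K_def)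

  \<comment> \<open>An admissible upper age is \<open>a\<close> itself if positive, and
    \<open>ac\<close> if \<open>a = 0\<close>.\<close>
  obtain a2 where a2: "a2 \<in> age_range am" "a \<in> {0..a2}"
    using a ac by (cases "a = 0") (auto simp: age_range_def)
  have cont_a: "continuous_on {0..1} (u a)"
    by (rule cont_age[OF a2])
  have LINT: "(LINT x:{0..1}|lborel. u a x) = integral {0..1} (u a)"
    by (rule set_borel_integral_eq_integral(2)[OF borel_integrable_atLeastAtMost'[OF cont_a]])
  show "(LINT x:{0..1}|lborel. u a x) \<le> C * B * ac * L / \<delta> * exp (- (\<delta> * \<Lambda> / (2 * d))) + 2 * \<delta> * L"
    unfolding LINT by (rule bound)
  show "0 \<le> (LINT x:{0..1}|lborel. u a x)"
    unfolding LINT by (intro integral_nonneg integrable_continuous_real cont_a nonneg[OF a2])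
qed

section \<open>Passage to the limit\<close>

text \<open>Order of choices: \<open>\<delta>\<close> is fixed first to make the layer term small,
  and only then does the growing rate kill the exponential despite the factor
  \<open>M / \<delta>\<close>.\<close>

lemma tendsto_zero_of_mass_bound:
  fixes m rate :: "'a \<Rightarrow> real"
  assumes rate: "filterlim rate at_top F" and "0 < L"
    and m: "\<And>\<delta>. 0 < \<delta> \<Longrightarrow> \<delta> < 1 / 2 \<Longrightarrow>
      \<forall>\<^sub>F t in F. 0 \<le> m t \<and> m t \<le> M / \<delta> * exp (- (\<delta> * rate t)) + 2 * \<delta> * L"
  shows "(m \<longlongrightarrow> 0) F"
proof (rule tendstoI)
  fix e :: real assume "0 < e"
  \<comment> \<open>The second entry gives \<open>2 * \<delta> * L \<le> e / 2\<close>; the first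
    keeps \<open>\<delta>\<close> below \<open>1 / 2\<close>.\<close>
  define \<delta> where "\<delta> = min (1 / 4) (e / (4 * L))"
  have \<delta>: "0 < \<delta>" "\<delta> < 1 / 2" "2 * \<delta> * L \<le> e / 2"
    using \<open>0 < e\<close> \<open>0 < L\<close> by (auto simp: \<delta>_def field_simps min_def)
  have "filterlim (\<lambda>t. \<delta> * rate t) at_top F"
    using \<delta>(1) by (intro filterlim_tendsto_pos_mult_at_top[OF tendsto_const _ rate])
  then have "((\<lambda>t. exp (- (\<delta> * rate t))) \<longlongrightarrow> 0) F"
    by (intro filterlim_compose[OF exp_at_bot]) (simp add: filterlim_uminus_at_top)
  then have "((\<lambda>t. M / \<delta> * exp (- (\<delta> * rate t))) \<longlongrightarrow> 0) F"
    by (rule tendsto_mult_right_zero)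
  then have "\<forall>\<^sub>F t in F. M / \<delta> * exp (- (\<delta> * rate t)) < e / 2"
    using \<open>0 < e\<close> by (intro order_tendstoD(2)) auto
  with m[OF \<delta>(1,2)] show "\<forall>\<^sub>F t in F. dist (m t) 0 < e"
  proof eventually_elim
    case (elim t)
    then have "0 \<le> m t" "m t < e"
      using \<delta>(3) by linarith+
    then show ?case by simp
  qed
qed

theorem theorem2p6:
  fixes am :: ereal and ac a :: real and \<beta> \<mu> f :: "real \<Rightarrow> real \<Rightarrow> real"
  assumes "0 < am"
    and "birth_rate am ac \<beta>"
    and "death_rate am \<mu>"
    and "birth_function f"
    and "1 < partial_u f 1 0 *
           (LINT a:{0..ac}|lebesgue. \<beta> a 1 * exp (- (LINT s:{0..a}|lebesgue. \<mu> s 1)))"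
    and "0 \<le> a" and "ereal a < am"
  shows "(\<forall>d>0. \<forall>u :: real \<Rightarrow> real \<Rightarrow> real \<Rightarrow> real.
            (\<forall>\<^sub>F \<Lambda> in at_top. positive_equilibrium am \<beta> \<mu> f d \<Lambda> (u \<Lambda>)) \<longrightarrow>
            ((\<lambda>\<Lambda>. LINT x:{0..1}|lborel. u \<Lambda> a x) \<longlongrightarrow> 0) at_top) \<and>
         (\<forall>\<Lambda>>0. \<forall>u :: real \<Rightarrow> real \<Rightarrow> real \<Rightarrow> real.
            (\<forall>\<^sub>F d in at_right 0. positive_equilibrium am \<beta> \<mu> f d \<Lambda> (u d)) \<longrightarrow>
            ((\<lambda>d. LINT x:{0..1}|lborel. u d a x) \<longlongrightarrow> 0) (at_right 0))"
proof -
  \<comment> \<open>The constants \<open>B\<close>, \<open>C\<close> and \<open>L\<close> depend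
    only on \<open>\<beta>\<close> and \<open>f\<close>, so a single bound covers every member of
    either family of equilibria.\<close>
  have "Linf_continuous_on {0..1} (age_range am) \<beta>"
    using assms(2) by (auto simp: birth_rate_def Linf_C2_on_def)
  then obtain B where B: "0 < B" "\<forall>x\<in>{0..1}. AE s in lebesgue. s \<in> age_range am \<longrightarrow> \<bar>\<beta> s x\<bar> \<le> B"
    using Linf_continuous_on_compact_bound[OF _ compact_Icc age_range_measurable] by blast
  obtain C where C: "0 < C" "\<forall>x\<in>{0..1}. \<forall>v\<ge>0. f x v \<le> C * v"
    using birth_function_linear_bound[OF assms(4)] by blast
  obtain L where L: "0 < L" "\<forall>x\<in>{0..1}. \<forall>v\<ge>0. f x v \<le> L"
    using assms(4) by (auto simp: birth_function_def Ball_def)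
  note bound = equilibrium_mass_bound[OF assms(2,3) _ B C L _ _ _ _ assms(6,7)]
  show ?thesis
  proof (intro conjI allI impI)
    fix d :: real and u :: "real \<Rightarrow> real \<Rightarrow> real \<Rightarrow> real"
    assume d: "0 < d" and u: "\<forall>\<^sub>F \<Lambda> in at_top. positive_equilibrium am \<beta> \<mu> f d \<Lambda> (u \<Lambda>)"
    have "filterlim (\<lambda>\<Lambda>. \<Lambda> / (2 * d)) at_top at_top"
      using d by real_asymp
    \<comment> \<open>For fixed \<open>d\<close> the discriminant condition holds once
      \<open>\<Lambda>\<close> is large.\<close>
    moreover have "\<forall>\<^sub>F \<Lambda>::real in at_top. 4 * d * (C * B) \<le> \<Lambda>\<^sup>2"
      by real_asymp
    ultimately show "((\<lambda>\<Lambda>. LINT x:{0..1}|lborel. u \<Lambda> a x) \<longlongrightarrow> 0) at_top"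
    proof (intro tendsto_zero_of_mass_bound[OF _ L(1), where M = "C * B * ac * L"])
      fix \<delta> :: real assume \<delta>: "0 < \<delta>" "\<delta> < 1 / 2"
      assume "\<forall>\<^sub>F \<Lambda> in at_top. 4 * d * (C * B) \<le> \<Lambda>\<^sup>2"
      with u show "\<forall>\<^sub>F \<Lambda> in at_top. 0 \<le> (LINT x:{0..1}|lborel. u \<Lambda> a x) \<and>
          (LINT x:{0..1}|lborel. u \<Lambda> a x) \<le> C * B * ac * L / \<delta> * exp (- (\<delta> * (\<Lambda> / (2 * d)))) + 2 * \<delta> * L"
        by eventually_elim (use bound[OF _ d _ \<delta>] in auto)
    qed
  next
    fix \<Lambda> :: real and u :: "real \<Rightarrow> real \<Rightarrow> real \<Rightarrow> real"
    assume \<Lambda>: "0 < \<Lambda>" and u: "\<forall>\<^sub>F d in at_right 0. positive_equilibrium am \<beta> \<mu> f d \<Lambda> (u d)"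
    have "filterlim (\<lambda>d. \<Lambda> / (2 * d)) at_top (at_right 0)"
      using \<Lambda> by real_asymp
    \<comment> \<open>For fixed \<open>\<Lambda> > 0\<close> it holds once \<open>d\<close> is
      small, its left side tending to 0.\<close>
    moreover have "\<forall>\<^sub>F d in at_right 0. 4 * d * (C * B) \<le> \<Lambda>\<^sup>2"
      using \<Lambda> by real_asymp
    ultimately show "((\<lambda>d. LINT x:{0..1}|lborel. u d a x) \<longlongrightarrow> 0) (at_right 0)"
    proof (intro tendsto_zero_of_mass_bound[OF _ L(1), where M = "C * B * ac * L"])
      fix \<delta> :: real assume \<delta>: "0 < \<delta>" "\<delta> < 1 / 2"
      assume "\<forall>\<^sub>F d in at_right 0. 4 * d * (C * B) \<le> \<Lambda>\<^sup>2"
      \<comment> \<open>Approaching 0 from the right supplies the positivity of \<open>d\<close>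
        that the bound requires.\<close>
      with u eventually_at_right_less[of 0] show "\<forall>\<^sub>F d in at_right 0. 0 \<le> (LINT x:{0..1}|lborel. u d a x) \<and>
          (LINT x:{0..1}|lborel. u d a x) \<le> C * B * ac * L / \<delta> * exp (- (\<delta> * (\<Lambda> / (2 * d)))) + 2 * \<delta> * L"
        by eventually_elim (use bound[OF _ _ _ \<delta>] in auto)
    qed
  qed
qed

end
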